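(* Let $A$ be a ring and let $E\subseteq A$ be a set of local units for $A$. Let $G$ be an abelian group and let $\alpha=(\{D_t\}_{t\in G},\{\alpha_t\}_{t\in G})$ be a partial action of $G$ on the ring $A$ such that each ideal $D_t$ has local units. Suppose that the partial skew group ring $R=A\star_\alpha G$ is associative. For $e\in E$ let $C_e$ denote the center of $e\delta_0\,R\,e\delta_0$. Then the following are equivalent: (1) $A\star_\alpha G$ is simple. (2) $A$ is $G$-simple and $C_e$ is a field for all $e\in E$.
   Context: Rings are not assumed unital. A set $E\subseteq A$ is a set of local units for a ring $A$ if every $e\in E$ satisfies $e^2=e$ and for every finite set $\{r_1,\dots,r_n\}\subseteq A$ there is $e\in E$ with $er_i=r_i=r_ie$ for all $i$. A ring (in particular an ideal viewed as a ring) has local units if such a set exists inside it. Ideals are two-sided. The abelian group $G$ is written additively with identity $0$. A partial action of $G$ on a ring $A$ is a pair $\alpha=(\{D_t\}_{t\in G},\{\alpha_t\}_{t\in G})$ where each $D_t$ is an ideal of $A$, each $\alpha_t:D_{-t}\to D_t$ is a ring isomorphism, $D_0=A$, $\alpha_0=\mathrm{id}_A$, $\alpha_t(D_{-t}\cap D_s)=D_t\cap D_{t+s}$, and $\alpha_t(\alpha_s(x))=\alpha_{t+s}(x)$ for all $x\in D_{-s}\cap D_{-s-t}$. The partial skew group ring $A\star_\alpha G$ is the set of finite formal sums $\sum_{t\in G}a_t\delta_t$ with $a_t\in D_t$ ($\delta_t$ being symbols), with the usual addition and with multiplication determined by $(a_t\delta_t)(b_s\delta_s)=\alpha_t(\alpha_{-t}(a_t)b_s)\delta_{t+s}$.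 An ideal $I\subseteq A$ is $G$-invariant if $\alpha_g(I\cap D_{-g})\subseteq I\cap D_g$ for all $g\in G$. $A$ is $G$-simple if $\{0\}$ and $A$ are its only $G$-invariant ideals. A ring is simple if its only ideals are $\{0\}$ and the whole ring. The center of $e\delta_0Re\delta_0$ is $C_e=\{x\in e\delta_0Re\delta_0: xy=yx\ \ \forall y\in e\delta_0Re\delta_0\}$.
   Formalization: Condition (2) asks C_e to be a field only for nonzero e in E; if 0 is in E, the literal statement fails (A a field, G trivial, E={0,1}), since C_0={0} is not a field. *)

theory Defs
  imports "HOL-Library.Poly_Mapping" "HOL-Algebra.Ring"
begin

text \<open>
  Non-unital rings are modelled by the type class \<open>ring\<close>, which does not assume a unit.  The ring
  \<open>A\<close> is the whole type \<open>'a\<close>; the group \<open>G\<close> is the whole type \<open>'g\<close>.  The partial skew group ring is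
  only a subset of \<open>'g \<Rightarrow>\<^sub>0 'a\<close>, with a multiplication that need not be associative, so ideals and
  simplicity are defined relative to a carrier \<open>S\<close> and a multiplication \<open>m\<close>; the additive structure
  is that of the ambient type.
\<close>

definition two_sided_ideal ::
  "'r::ab_group_add set \<Rightarrow> ('r \<Rightarrow> 'r \<Rightarrow> 'r) \<Rightarrow> 'r set \<Rightarrow> bool" where
  "two_sided_ideal S m I \<longleftrightarrow>
     I \<subseteq> S \<and> 0 \<in> I \<and> (\<forall>x\<in>I. \<forall>y\<in>I. x + y \<in> I) \<and> (\<forall>x\<in>I. - x \<in> I) \<and>
     (\<forall>r\<in>S. \<forall>x\<in>I. m r x \<in> I \<and> m x r \<in> I)"

definition simple_on :: "'r::ab_group_add set \<Rightarrow> ('r \<Rightarrow> 'r \<Rightarrow> 'r) \<Rightarrow> bool" where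
  "simple_on S m \<longleftrightarrow> (\<forall>I. two_sided_ideal S m I \<longrightarrow> I = {0} \<or> I = S)"

definition center_on :: "'r set \<Rightarrow> ('r \<Rightarrow> 'r \<Rightarrow> 'r) \<Rightarrow> 'r set" where
  "center_on S m = {x \<in> S. \<forall>y\<in>S. m x y = m y x}"

definition local_units_for :: "'a::ring set \<Rightarrow> 'a set \<Rightarrow> bool" where
  "local_units_for S E \<longleftrightarrow>
     E \<subseteq> S \<and> (\<forall>e\<in>E. e * e = e) \<and>
     (\<forall>F. finite F \<and> F \<subseteq> S \<longrightarrow> (\<exists>e\<in>E. \<forall>r\<in>F. e * r = r \<and> r * e = r))"

definition has_local_units :: "'a::ring set \<Rightarrow> bool" where
  "has_local_units S \<longleftrightarrow> (\<exists>E. local_units_for S E)"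

definition ring_iso_betw :: "('a::ring \<Rightarrow> 'a) \<Rightarrow> 'a set \<Rightarrow> 'a set \<Rightarrow> bool" where
  "ring_iso_betw f I J \<longleftrightarrow>
     bij_betw f I J \<and>
     (\<forall>x\<in>I. \<forall>y\<in>I. f (x + y) = f x + f y) \<and> (\<forall>x\<in>I. \<forall>y\<in>I. f (x * y) = f x * f y)"

text \<open>
  Each \<open>\<alpha> t\<close> is a total function on \<open>'a\<close>, but only its values on \<open>D (- t)\<close> are constrained, and only
  those are ever used below.
\<close>

locale partial_action =
  fixes D :: "'g::ab_group_add \<Rightarrow> 'a::ring set"
    and \<alpha> :: "'g \<Rightarrow> 'a \<Rightarrow> 'a"
  assumes ideal_D: "two_sided_ideal UNIV (*) (D t)"
    and iso_\<alpha>: "ring_iso_betw (\<alpha> t) (D (- t)) (D t)"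
    and D_zero: "D 0 = UNIV"
    and \<alpha>_zero: "\<alpha> 0 x = x"
    and \<alpha>_image: "\<alpha> t ` (D (- t) \<inter> D s) = D t \<inter> D (t + s)"
    and \<alpha>_comp: "x \<in> D (- s) \<inter> D (- s - t) \<Longrightarrow> \<alpha> t (\<alpha> s x) = \<alpha> (t + s) x"

text \<open>
  The formal sum of the \<open>a\<^sub>t \<delta>\<^sub>t\<close> is the finitely supported function \<open>t \<mapsto> a\<^sub>t\<close>; in particular
  \<open>a \<delta>\<^sub>t\<close> is \<open>Poly_Mapping.single t a\<close>.
\<close>

definition skew_carrier :: "('g \<Rightarrow> 'a::ring set) \<Rightarrow> ('g \<Rightarrow>\<^sub>0 'a) set" where
  "skew_carrier D = {x. \<forall>t. Poly_Mapping.lookup x t \<in> D t}"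

definition skew_mult ::
  "('g::ab_group_add \<Rightarrow> 'a::ring \<Rightarrow> 'a) \<Rightarrow> ('g \<Rightarrow>\<^sub>0 'a) \<Rightarrow> ('g \<Rightarrow>\<^sub>0 'a) \<Rightarrow> ('g \<Rightarrow>\<^sub>0 'a)" where
  "skew_mult \<alpha> x y =
     (\<Sum>t\<in>Poly_Mapping.keys x. \<Sum>s\<in>Poly_Mapping.keys y.
        Poly_Mapping.single (t + s) (\<alpha> t (\<alpha> (- t) (Poly_Mapping.lookup x t) * Poly_Mapping.lookup y s)))"

definition invariant_ideal ::
  "('g::ab_group_add \<Rightarrow> 'a::ring set) \<Rightarrow> ('g \<Rightarrow> 'a \<Rightarrow> 'a) \<Rightarrow> 'a set \<Rightarrow> bool" where
  "invariant_ideal D \<alpha> I \<longleftrightarrow>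
     two_sided_ideal UNIV (*) I \<and> (\<forall>g. \<alpha> g ` (I \<inter> D (- g)) \<subseteq> I \<inter> D g)"

definition G_simple :: "('g::ab_group_add \<Rightarrow> 'a::ring set) \<Rightarrow> ('g \<Rightarrow> 'a \<Rightarrow> 'a) \<Rightarrow> bool" where
  "G_simple D \<alpha> \<longleftrightarrow> (\<forall>I. invariant_ideal D \<alpha> I \<longrightarrow> I = {0} \<or> I = UNIV)"

text \<open>The corner \<open>e\<delta>\<^sub>0 R e\<delta>\<^sub>0\<close> of the partial skew group ring \<open>R\<close>.\<close>

definition skew_corner ::
  "('g::ab_group_add \<Rightarrow> 'a::ring set) \<Rightarrow> ('g \<Rightarrow> 'a \<Rightarrow> 'a) \<Rightarrow> 'a \<Rightarrow> ('g \<Rightarrow>\<^sub>0 'a) set" where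
  "skew_corner D \<alpha> e =
     (\<lambda>r. skew_mult \<alpha> (skew_mult \<alpha> (Poly_Mapping.single 0 e) r) (Poly_Mapping.single 0 e))
       ` skew_carrier D"

text \<open>
  The centre \<open>C\<^sub>e\<close> of the corner, as a record, so that the library predicate \<open>field\<close> applies; its
  identity is \<open>e\<delta>\<^sub>0\<close>, the identity of the corner.  A set of local units may contain \<open>0\<close>, and
  \<open>C\<^sub>0\<close> is the zero ring, which is never a field; the idempotent \<open>0\<close> therefore has to be excluded
  when all \<open>C\<^sub>e\<close> are required to be fields.
\<close>

definition corner_center ::
  "('g::ab_group_add \<Rightarrow> 'a::ring set) \<Rightarrow> ('g \<Rightarrow> 'a \<Rightarrow> 'a) \<Rightarrow> 'a \<Rightarrow> ('g \<Rightarrow>\<^sub>0 'a) ring" where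
  "corner_center D \<alpha> e =
     \<lparr>carrier = center_on (skew_corner D \<alpha> e) (skew_mult \<alpha>),
      mult = skew_mult \<alpha>,
      one = Poly_Mapping.single 0 e,
      zero = 0,
      add = (+)\<rparr>"

context partial_action
begin

lemma zero_in_D: "0 \<in> D t"
  using ideal_D[of t] by (simp add: two_sided_ideal_def)

lemma \<alpha>_at_zero: "\<alpha> t 0 = 0"
proof -
  have "\<alpha> t (0 + 0) = \<alpha> t 0 + \<alpha> t 0"
    using iso_\<alpha>[of t] zero_in_D[of "- t"] unfolding ring_iso_betw_def by blast
  then show ?thesis by simp
qed

lemma skew_mult_single:
  "skew_mult \<alpha> (Poly_Mapping.single t a) (Poly_Mapping.single s b) =
     Poly_Mapping.single (t + s) (\<alpha> t (\<alpha> (- t) a * b))"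
  by (simp add: skew_mult_def \<alpha>_at_zero)

lemma skew_mult_closed:
  assumes "x \<in> skew_carrier D" "y \<in> skew_carrier D"
  shows "skew_mult \<alpha> x y \<in> skew_carrier D"
proof -
  have add: "u + v \<in> D t" if "u \<in> D t" "v \<in> D t" for u v t
    using that ideal_D[of t] by (simp add: two_sided_ideal_def)
  have sum: "(\<Sum>i\<in>K. f i) \<in> D t" if "\<And>i. i \<in> K \<Longrightarrow> f i \<in> D t" for K :: "'g set" and f t
    using that by (induction K rule: infinite_finite_induct) (auto intro: add zero_in_D)
  have coeff_in: "\<alpha> t (\<alpha> (- t) (Poly_Mapping.lookup x t) * Poly_Mapping.lookup y s) \<in> D (t + s)" for t s
  proof -
    have "\<alpha> (- t) (Poly_Mapping.lookup x t) \<in> D (- t)"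
      using iso_\<alpha>[of "- t"] assms(1)
      by (auto simp: ring_iso_betw_def skew_carrier_def bij_betw_def)
    then have "\<alpha> (- t) (Poly_Mapping.lookup x t) * Poly_Mapping.lookup y s \<in> D (- t) \<inter> D s"
      using ideal_D[of "- t"] ideal_D[of s] assms(2)
      by (auto simp: two_sided_ideal_def skew_carrier_def)
    then show ?thesis using \<alpha>_image[of t s] by blast
  qed
  show ?thesis
    unfolding skew_carrier_def skew_mult_def
    by (auto simp: Poly_Mapping.lookup_sum lookup_single when_def intro!: sum zero_in_D coeff_in)
qed

end

end

theory Submission
  imports Defs
begin

text \<open>
  An invariant ideal \<open>I\<close> of \<open>A\<close> yields the ideal of all \<open>\<Sum> a\<^sub>t\<delta>\<^sub>t\<close> with \<open>a\<^sub>t \<in> I\<close>, and a central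
  element \<open>z\<close> of a corner \<open>eRe\<close> yields the ideal \<open>{r. e(RrR)e \<subseteq> z(eRe)}\<close>; simplicity of \<open>R\<close> makes
  both trivial.  Conversely, let \<open>x \<noteq> 0\<close> have minimal support in an ideal \<open>J\<close>, translated so that
  \<open>x\<^sub>0 \<noteq> 0\<close>.  As \<open>G\<close> is abelian, conjugation by homogeneous elements preserves supports, so the
  coefficients \<open>b\<^sub>0\<close> of those \<open>b \<in> J\<close> supported in \<open>supp x\<close> form an invariant ideal, hence all of
  \<open>A\<close>.  A choice with \<open>b\<^sub>0 = e\<close> and \<open>b \<in> eRe\<close> has commutators with homogeneous elements of the
  corner of smaller support, so \<open>b\<close> is central, hence invertible, and \<open>e\<delta>\<^sub>0 \<in> J\<close>.
\<close>

context partial_action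
begin

section \<open>Rules for the ideals \<open>D t\<close> and the maps
  \<open>\<alpha> t\<close>\<close>

lemma D_add: "a \<in> D t \<Longrightarrow> b \<in> D t \<Longrightarrow> a + b \<in> D t"
  and D_minus: "a \<in> D t \<Longrightarrow> - a \<in> D t"
  and D_mult_right: "a \<in> D t \<Longrightarrow> a * c \<in> D t"
  using ideal_D[of t] by (auto simp: two_sided_ideal_def)

lemma \<alpha>_in: "a \<in> D (- t) \<Longrightarrow> \<alpha> t a \<in> D t"
  using iso_\<alpha>[of t] by (auto simp: ring_iso_betw_def bij_betw_def)

lemma \<alpha>_in': "a \<in> D t \<Longrightarrow> \<alpha> (- t) a \<in> D (- t)"
  using \<alpha>_in[of a "- t"] by simp

lemma \<alpha>_add: "a \<in> D (- t) \<Longrightarrow> b \<in> D (- t) \<Longrightarrow> \<alpha> t (a + b) = \<alpha> t a + \<alpha> t b"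
  using iso_\<alpha>[of t] by (auto simp: ring_iso_betw_def)

text \<open>For \<open>s = - t\<close> the composition axiom has domain
  \<open>D t \<inter> D 0\<close>, which is all of \<open>D t\<close>, and its right-hand side is
  \<open>\<alpha> 0 a = a\<close>.\<close>

lemma \<alpha>_inverse: "a \<in> D t \<Longrightarrow> \<alpha> t (\<alpha> (- t) a) = a"
  using \<alpha>_comp[of a "- t" t] by (simp add: D_zero \<alpha>_zero)

lemma \<alpha>_inverse': "a \<in> D (- t) \<Longrightarrow> \<alpha> (- t) (\<alpha> t a) = a"
  using \<alpha>_inverse[of a "- t"] by simp

section \<open>Notation and the additive group \<open>R\<close>\<close>

abbreviation R :: "('g \<Rightarrow>\<^sub>0 'a) set" where "R \<equiv> skew_carrier D"

abbreviation times_R :: "('g \<Rightarrow>\<^sub>0 'a) \<Rightarrow> ('g \<Rightarrow>\<^sub>0 'a) \<Rightarrow> ('g \<Rightarrow>\<^sub>0 'a)" (infixl "\<star>" 70)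
  where "x \<star> y \<equiv> skew_mult \<alpha> x y"

abbreviation \<delta> :: "'g \<Rightarrow> 'a \<Rightarrow> ('g \<Rightarrow>\<^sub>0 'a)" where "\<delta> t a \<equiv> Poly_Mapping.single t a"

abbreviation coeff :: "('g \<Rightarrow>\<^sub>0 'a) \<Rightarrow> 'g \<Rightarrow> 'a" where "coeff \<equiv> Poly_Mapping.lookup"

abbreviation keys :: "('g \<Rightarrow>\<^sub>0 'a) \<Rightarrow> 'g set" where "keys \<equiv> Poly_Mapping.keys"

lemma coeff_in: "x \<in> R \<Longrightarrow> coeff x t \<in> D t"
  by (simp add: skew_carrier_def)

lemma single_in_R: "a \<in> D t \<Longrightarrow> \<delta> t a \<in> R"
  by (simp add: skew_carrier_def lookup_single when_def zero_in_D)

lemma single_zero_in_R: "\<delta> 0 a \<in> R"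
  by (simp add: single_in_R D_zero)

lemma zero_in_R: "0 \<in> R"
  by (simp add: skew_carrier_def zero_in_D)

lemma add_in_R: "x \<in> R \<Longrightarrow> y \<in> R \<Longrightarrow> x + y \<in> R"
  by (simp add: skew_carrier_def lookup_add D_add)

lemma minus_in_R: "x \<in> R \<Longrightarrow> - x \<in> R"
  by (simp add: skew_carrier_def D_minus)

section \<open>Biadditivity of the skew product\<close>

text \<open>Indices outside the supports contribute nothing because \<open>\<alpha> t 0 = 0\<close>.
  This permits a common index set for \<open>x\<close>, \<open>x'\<close> and \<open>x + x'\<close>,
  whose supports differ.\<close>

lemma skew_mult_superset:
  assumes "finite F" "keys x \<subseteq> F" "finite H" "keys y \<subseteq> H"
  shows "x \<star> y = (\<Sum>t\<in>F. \<Sum>s\<in>H. \<delta> (t + s) (\<alpha> t (\<alpha> (- t) (coeff x t) * coeff y s)))"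
proof -
  have "x \<star> y = (\<Sum>t\<in>keys x. \<Sum>s\<in>H. \<delta> (t + s) (\<alpha> t (\<alpha> (- t) (coeff x t) * coeff y s)))"
    unfolding skew_mult_def
    using assms by (intro sum.cong sum.mono_neutral_left) (auto simp: in_keys_iff \<alpha>_at_zero)
  also have "\<dots> = (\<Sum>t\<in>F. \<Sum>s\<in>H. \<delta> (t + s) (\<alpha> t (\<alpha> (- t) (coeff x t) * coeff y s)))"
    using assms by (intro sum.mono_neutral_left) (auto simp: in_keys_iff \<alpha>_at_zero)
  finally show ?thesis .
qed

text \<open>Since \<open>\<alpha> (- t) (coeff x t)\<close> lies in the ideal
  \<open>D (- t)\<close>, so does its product with any coefficient of \<open>y\<close>. Hence
  \<open>\<alpha> t\<close> is applied inside its domain, the only place where it is known to be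
  additive.\<close>

lemma skew_mult_add_left:
  assumes "x \<in> R" "x' \<in> R" "y \<in> R"
  shows "(x + x') \<star> y = x \<star> y + x' \<star> y"
proof -
  let ?F = "keys x \<union> keys x'"
  have c: "\<alpha> t (\<alpha> (- t) (coeff x t + coeff x' t) * coeff y s) =
      \<alpha> t (\<alpha> (- t) (coeff x t) * coeff y s) + \<alpha> t (\<alpha> (- t) (coeff x' t) * coeff y s)" for t s
    using coeff_in[OF assms(1), of t] coeff_in[OF assms(2), of t]
    by (simp add: \<alpha>_add \<alpha>_in' D_mult_right distrib_right)
  show ?thesis
    unfolding skew_mult_superset[of ?F x "keys y" y, simplified]
      skew_mult_superset[of ?F x' "keys y" y, simplified]
      skew_mult_superset[of ?F "x + x'" "keys y" y, simplified, OF keys_add]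
    by (simp add: lookup_add c single_add sum.distrib)
qed

lemma skew_mult_add_right:
  assumes "x \<in> R" "y \<in> R" "y' \<in> R"
  shows "x \<star> (y + y') = x \<star> y + x \<star> y'"
proof -
  let ?H = "keys y \<union> keys y'"
  have c: "\<alpha> t (\<alpha> (- t) (coeff x t) * (coeff y s + coeff y' s)) =
      \<alpha> t (\<alpha> (- t) (coeff x t) * coeff y s) + \<alpha> t (\<alpha> (- t) (coeff x t) * coeff y' s)" for t s
    using coeff_in[OF assms(1), of t]
    by (simp add: \<alpha>_add \<alpha>_in' D_mult_right distrib_left)
  show ?thesis
    unfolding skew_mult_superset[of "keys x" x ?H y, simplified]
      skew_mult_superset[of "keys x" x ?H y', simplified]
      skew_mult_superset[of "keys x" x ?H "y + y'", simplified, OF keys_add]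
    by (simp add: lookup_add c single_add sum.distrib)
qed

lemma skew_mult_zero_left [simp]: "0 \<star> y = 0"
  and skew_mult_zero_right [simp]: "y \<star> 0 = 0"
  by (simp_all add: skew_mult_def)

lemma skew_mult_minus_left: "x \<in> R \<Longrightarrow> y \<in> R \<Longrightarrow> (- x) \<star> y = - (x \<star> y)"
  using skew_mult_add_left[of x "- x" y] by (simp add: minus_in_R minus_unique)

lemma skew_mult_minus_right: "x \<in> R \<Longrightarrow> y \<in> R \<Longrightarrow> x \<star> (- y) = - (x \<star> y)"
  using skew_mult_add_right[of x y "- y"] by (simp add: minus_in_R minus_unique)

section \<open>Products with homogeneous elements\<close>

lemma coeff_single_mult:
  "coeff (\<delta> t a \<star> x) u = \<alpha> t (\<alpha> (- t) a * coeff x (u - t))"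
proof -
  have eq: "t + s = u \<longleftrightarrow> s = u - t" for s
    by (auto simp: algebra_simps)
  \<comment> \<open>Only \<open>s = u - t\<close> contributes in degree \<open>u\<close>. Inserting
    it into the index set avoids a case distinction on whether it belongs to the support.\<close>
  have "\<delta> t a \<star> x = (\<Sum>s\<in>insert (u - t) (keys x). \<delta> (t + s) (\<alpha> t (\<alpha> (- t) a * coeff x s)))"
    by (subst skew_mult_superset[of "{t}" _ "insert (u - t) (keys x)"]) auto
  then show ?thesis
    by (simp add: Poly_Mapping.lookup_sum lookup_single when_def eq)
qed

lemma coeff_mult_single:
  "coeff (x \<star> \<delta> s b) u = \<alpha> (u - s) (\<alpha> (s - u) (coeff x (u - s)) * b)"
proof -
  have eq: "t + s = u \<longleftrightarrow> t = u - s" for t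
    by (auto simp: algebra_simps)
  have "x \<star> \<delta> s b = (\<Sum>t\<in>insert (u - s) (keys x). \<delta> (t + s) (\<alpha> t (\<alpha> (- t) (coeff x t) * b)))"
    by (subst skew_mult_superset[of "insert (u - s) (keys x)" _ "{s}"]) auto
  then show ?thesis
    by (simp add: Poly_Mapping.lookup_sum lookup_single when_def eq)
qed

lemma coeff_single_zero_mult: "coeff (\<delta> 0 a \<star> x) u = a * coeff x u"
  by (simp add: coeff_single_mult \<alpha>_zero)

lemma coeff_mult_single_zero: "coeff (x \<star> \<delta> 0 b) u = \<alpha> u (\<alpha> (- u) (coeff x u) * b)"
  by (simp add: coeff_mult_single)

text \<open>As \<open>G\<close> is abelian, a homogeneous factor of degree \<open>t\<close> shifts
  supports by the same translation from the left as from the right. Thus factors of degrees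
  \<open>g\<close> and \<open>- g\<close> on either side leave the support inside the old one, and a
  commutator with a homogeneous element is supported in a single translate.\<close>

lemma keys_single_mult: "keys (\<delta> t a \<star> x) \<subseteq> (+) t ` keys x"
proof
  fix u assume "u \<in> keys (\<delta> t a \<star> x)"
  then have "u - t \<in> keys x"
    by (auto simp: in_keys_iff coeff_single_mult \<alpha>_at_zero)
  then show "u \<in> (+) t ` keys x"
    by (intro image_eqI[of _ _ "u - t"]) auto
qed

lemma keys_mult_single: "keys (x \<star> \<delta> t a) \<subseteq> (+) t ` keys x"
proof
  fix u assume "u \<in> keys (x \<star> \<delta> t a)"
  then have "u - t \<in> keys x"
    by (auto simp: in_keys_iff coeff_mult_single \<alpha>_at_zero)
  then show "u \<in> (+) t ` keys x"
    by (intro image_eqI[of _ _ "u - t"]) auto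
qed

text \<open>An element is the sum of its homogeneous components, and the product is additive in each
  argument.\<close>

lemma commutes_if_commutes_homogeneous:
  assumes "x \<in> R" "y \<in> R"
    and comm: "\<And>t. x \<star> \<delta> t (coeff y t) = \<delta> t (coeff y t) \<star> x"
  shows "x \<star> y = y \<star> x"
proof -
  \<comment> \<open>Membership in \<open>R\<close> is carried through the induction because
    additivity of the product is available only on \<open>R\<close>.\<close>
  have "(\<Sum>t\<in>F. \<delta> t (coeff y t)) \<in> R \<and>
      x \<star> (\<Sum>t\<in>F. \<delta> t (coeff y t)) = (\<Sum>t\<in>F. \<delta> t (coeff y t)) \<star> x" if "finite F" for F
    using that
  proof induction
    case (insert t F)
    have "\<delta> t (coeff y t) \<in> R"
      using assms(2) by (simp add: single_in_R coeff_in)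
    with insert show ?case
      by (simp add: skew_mult_add_left skew_mult_add_right assms(1) comm add_in_R)
  qed (simp add: zero_in_R)
  moreover have "(\<Sum>t\<in>keys y. \<delta> t (coeff y t)) = y"
    by (rule poly_mapping_eqI) (simp add: Poly_Mapping.lookup_sum lookup_single when_def in_keys_iff)
  ultimately show ?thesis
    using finite_keys[of y] by metis
qed

section \<open>Invariant ideals of \<open>A\<close> extend to ideals of \<open>R\<close>\<close>

lemma G_simple_if_simple:
  assumes "simple_on R (skew_mult \<alpha>)"
  shows "G_simple D \<alpha>"
  unfolding G_simple_def
proof (intro allI impI)
  fix I assume I: "invariant_ideal D \<alpha> I"
  then have zero: "0 \<in> I" and add: "\<And>a b. a \<in> I \<Longrightarrow> b \<in> I \<Longrightarrow> a + b \<in> I"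
    and minus: "\<And>a. a \<in> I \<Longrightarrow> - a \<in> I"
    and left: "\<And>a c. a \<in> I \<Longrightarrow> c * a \<in> I" and right: "\<And>a c. a \<in> I \<Longrightarrow> a * c \<in> I"
    and inv: "\<And>g a. a \<in> I \<Longrightarrow> a \<in> D (- g) \<Longrightarrow> \<alpha> g a \<in> I"
    by (auto simp: invariant_ideal_def two_sided_ideal_def image_subset_iff)
  define J where "J = {x \<in> R. \<forall>t. coeff x t \<in> I}"
  have sum: "(\<Sum>i\<in>K. f i) \<in> I" if "\<And>i. i \<in> K \<Longrightarrow> f i \<in> I" for K :: "'g set" and f
    using that by (induction K rule: infinite_finite_induct) (auto intro: add zero)
  have closed: "x \<star> y \<in> J" if x: "x \<in> R" and y: "y \<in> R" and xy: "x \<in> J \<or> y \<in> J" for x y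
  proof -
    have "\<alpha> t (\<alpha> (- t) (coeff x t) * coeff y s) \<in> I" for t s
    proof (rule inv)
      have D: "\<alpha> (- t) (coeff x t) \<in> D (- t)"
        using x by (simp add: \<alpha>_in' coeff_in)
      then show "\<alpha> (- t) (coeff x t) * coeff y s \<in> D (- t)"
        by (rule D_mult_right)
      \<comment> \<open>If \<open>y \<in> J\<close>, the right factor is in \<open>I\<close>. If
        \<open>x \<in> J\<close>, invariance under \<open>\<alpha> (- t)\<close> puts the left
        factor in \<open>I\<close>.\<close>
      show "\<alpha> (- t) (coeff x t) * coeff y s \<in> I"
        using xy inv[of "coeff x t" "- t"] x coeff_in[of x t] by (auto simp: J_def left right)
    qed
    then show ?thesis
      using skew_mult_closed[OF x y]
      by (auto simp: J_def skew_mult_def Poly_Mapping.lookup_sum lookup_single when_def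
          intro!: sum zero)
  qed
  have "two_sided_ideal R (skew_mult \<alpha>) J"
    using closed
    by (auto simp: two_sided_ideal_def) (auto simp: J_def zero_in_R zero add_in_R lookup_add add
        minus_in_R minus)
  then have "J = {0} \<or> J = R"
    using assms by (auto simp: simple_on_def)
  \<comment> \<open>The degree-zero elements recover \<open>I\<close> from \<open>J\<close>, so the
    dichotomy for \<open>J\<close> passes to \<open>I\<close>.\<close>
  moreover have "\<delta> 0 a \<in> J \<longleftrightarrow> a \<in> I" for a
    by (auto simp: J_def single_zero_in_R lookup_single when_def zero)
  moreover have "\<delta> 0 a \<in> {0} \<longleftrightarrow> a = 0" for a
    by (metis lookup_single_eq lookup_zero single_zero singleton_iff)
  ultimately show "I = {0} \<or> I = UNIV"
    using single_zero_in_R by auto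
qed

end

section \<open>Corners and their centers\<close>

text \<open>Associativity is asked for on \<open>R\<close> only, since the maps
  \<open>\<alpha> t\<close> are unconstrained outside their domains.\<close>

locale assoc_partial_action = partial_action +
  assumes assoc: "x \<in> skew_carrier D \<Longrightarrow> y \<in> skew_carrier D \<Longrightarrow> z \<in> skew_carrier D \<Longrightarrow>
    skew_mult \<alpha> (skew_mult \<alpha> x y) z = skew_mult \<alpha> x (skew_mult \<alpha> y z)"
begin

lemma single_idem: "e * e = e \<Longrightarrow> \<delta> 0 e \<star> \<delta> 0 e = \<delta> 0 e"
  by (simp add: skew_mult_single \<alpha>_zero)

text \<open>Idempotence of \<open>e\<close> turns the image that defines the corner into two
  fixed-point equations. Conversely, an element satisfying them is its own preimage.\<close>

lemma mem_skew_corner_iff: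
  assumes "e * e = e"
  shows "y \<in> skew_corner D \<alpha> e \<longleftrightarrow> y \<in> R \<and> \<delta> 0 e \<star> y = y \<and> y \<star> \<delta> 0 e = y"
proof
  assume "y \<in> skew_corner D \<alpha> e"
  then obtain r where r: "r \<in> R" "y = \<delta> 0 e \<star> r \<star> \<delta> 0 e"
    by (auto simp: skew_corner_def)
  have "\<delta> 0 e \<star> y = (\<delta> 0 e \<star> \<delta> 0 e) \<star> r \<star> \<delta> 0 e" "y \<star> \<delta> 0 e = \<delta> 0 e \<star> r \<star> (\<delta> 0 e \<star> \<delta> 0 e)"
    using r by (simp_all add: assoc skew_mult_closed single_zero_in_R)
  then show "y \<in> R \<and> \<delta> 0 e \<star> y = y \<and> y \<star> \<delta> 0 e = y"
    using r single_idem[OF assms] by (simp add: skew_mult_closed single_zero_in_R)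
next
  assume "y \<in> R \<and> \<delta> 0 e \<star> y = y \<and> y \<star> \<delta> 0 e = y"
  then show "y \<in> skew_corner D \<alpha> e"
    by (auto simp: skew_corner_def intro!: image_eqI[of _ _ y])
qed

lemma skew_corner_closed:
  assumes "e * e = e"
  shows "\<delta> 0 e \<in> skew_corner D \<alpha> e"
    and "0 \<in> skew_corner D \<alpha> e"
    and "x \<in> skew_corner D \<alpha> e \<Longrightarrow> y \<in> skew_corner D \<alpha> e \<Longrightarrow> x + y \<in> skew_corner D \<alpha> e"
    and "x \<in> skew_corner D \<alpha> e \<Longrightarrow> - x \<in> skew_corner D \<alpha> e"
    and "x \<in> skew_corner D \<alpha> e \<Longrightarrow> y \<in> skew_corner D \<alpha> e \<Longrightarrow> x \<star> y \<in> skew_corner D \<alpha> e"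
proof -
  show "x \<star> y \<in> skew_corner D \<alpha> e" if x: "x \<in> skew_corner D \<alpha> e" and y: "y \<in> skew_corner D \<alpha> e"
  proof -
    have "x \<in> R" "y \<in> R" using x y assms by (auto simp: mem_skew_corner_iff)
    then have "\<delta> 0 e \<star> (x \<star> y) = (\<delta> 0 e \<star> x) \<star> y" "x \<star> y \<star> \<delta> 0 e = x \<star> (y \<star> \<delta> 0 e)"
      by (simp_all add: assoc single_zero_in_R)
    then show ?thesis
      using x y by (simp add: mem_skew_corner_iff assms skew_mult_closed)
  qed
qed (auto simp: mem_skew_corner_iff assms single_idem single_zero_in_R zero_in_R add_in_R
      minus_in_R skew_mult_add_left skew_mult_add_right skew_mult_minus_left skew_mult_minus_right)

lemma mem_center_iff:
  assumes "e * e = e"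
  shows "z \<in> carrier (corner_center D \<alpha> e) \<longleftrightarrow>
    z \<in> skew_corner D \<alpha> e \<and> (\<forall>y\<in>skew_corner D \<alpha> e. z \<star> y = y \<star> z)"
  by (simp add: corner_center_def center_on_def)

text \<open>The axioms are inherited from \<open>R\<close>. The case \<open>e = 0\<close> is
  covered: it gives the zero ring, which \<open>cring\<close> admits.\<close>

lemma cring_corner_center:
  assumes e: "e * e = e"
  shows "cring (corner_center D \<alpha> e)"
proof -
  let ?C = "corner_center D \<alpha> e" and ?K = "skew_corner D \<alpha> e"
  note mem = mem_center_iff[OF e] and K = skew_corner_closed[OF e] and iff = mem_skew_corner_iff[OF e]
  have KR: "\<And>y. y \<in> ?K \<Longrightarrow> y \<in> R" by (simp add: iff)
  have add: "x + y \<in> carrier ?C" if "x \<in> carrier ?C" "y \<in> carrier ?C" for x y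
    using that by (simp add: mem K skew_mult_add_left skew_mult_add_right KR)
  have minus: "- x \<in> carrier ?C" if "x \<in> carrier ?C" for x
    using that by (simp add: mem K skew_mult_minus_left skew_mult_minus_right KR)
  have CK: "\<And>x. x \<in> carrier ?C \<Longrightarrow> x \<in> ?K"
    and comm: "\<And>x y. x \<in> carrier ?C \<Longrightarrow> y \<in> ?K \<Longrightarrow> x \<star> y = y \<star> x"
    by (auto simp only: mem)
  have mult: "x \<star> y \<in> carrier ?C" if x: "x \<in> carrier ?C" and y: "y \<in> carrier ?C" for x y
  proof -
    have "x \<star> y \<star> w = w \<star> (x \<star> y)" if w: "w \<in> ?K" for w
    proof -
      have R: "x \<in> R" "y \<in> R" "w \<in> R" using x y w by (auto intro: KR CK)
      have "x \<star> y \<star> w = x \<star> (y \<star> w)" using R by (simp only: assoc)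
      also have "\<dots> = x \<star> w \<star> y" using R by (simp only: assoc comm[OF y w])
      also have "\<dots> = w \<star> (x \<star> y)" using R by (simp only: assoc comm[OF x w])
      finally show ?thesis .
    qed
    then show ?thesis unfolding mem using K(5) CK x y by blast
  qed
  have sel: "add ?C = (+)" "mult ?C = skew_mult \<alpha>" "one ?C = \<delta> 0 e" "zero ?C = 0"
    by (simp_all add: corner_center_def)
  have one: "\<delta> 0 e \<in> carrier ?C"
    using K(1) by (simp add: mem iff)
  show ?thesis
  proof (rule cringI)
    show "abelian_group ?C"
    proof (rule abelian_groupI)
      fix x assume "x \<in> carrier ?C"
      then show "\<exists>y\<in>carrier ?C. y \<oplus>\<^bsub>?C\<^esub> x = \<zero>\<^bsub>?C\<^esub>"
        by (intro bexI[of _ "- x"] minus) (simp_all add: sel)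
    next
      show "\<zero>\<^bsub>?C\<^esub> \<in> carrier ?C" by (simp add: sel mem K)
    qed (simp_all add: sel add ac_simps)
    show "comm_monoid ?C"
    proof (rule comm_monoidI)
      show "\<one>\<^bsub>?C\<^esub> \<otimes>\<^bsub>?C\<^esub> x = x" if "x \<in> carrier ?C" for x
        using CK[OF that] by (simp add: sel iff)
      show "x \<otimes>\<^bsub>?C\<^esub> y = y \<otimes>\<^bsub>?C\<^esub> x" if "x \<in> carrier ?C" "y \<in> carrier ?C" for x y
        using comm[OF that(1) CK[OF that(2)]] by (simp only: sel)
    qed (simp_all add: sel one mult assoc KR CK)
    show "(x \<oplus>\<^bsub>?C\<^esub> y) \<otimes>\<^bsub>?C\<^esub> z = x \<otimes>\<^bsub>?C\<^esub> z \<oplus>\<^bsub>?C\<^esub> y \<otimes>\<^bsub>?C\<^esub> z"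
      if "x \<in> carrier ?C" "y \<in> carrier ?C" "z \<in> carrier ?C" for x y z
      using that by (simp add: sel skew_mult_add_left KR CK)
  qed
qed

section \<open>Simplicity makes the centers fields\<close>

text \<open>For a nonzero central \<open>x\<close>, the ideal \<open>J\<close> of all
  \<open>r\<close> with \<open>e(RrR)e\<close> inside \<open>x(eRe)\<close> contains
  \<open>x\<close>, so it is \<open>R\<close>, and \<open>e\<close> becomes a multiple of
  \<open>x\<close>. Working with \<open>J\<close> instead of the ideal generated by \<open>x\<close>
  avoids finite sums of products.\<close>

lemma field_corner_center_if_simple:
  assumes simple: "simple_on R (skew_mult \<alpha>)" and e: "e * e = e" "e \<noteq> 0"
  shows "field (corner_center D \<alpha> e)"
proof -
  let ?C = "corner_center D \<alpha> e" and ?K = "skew_corner D \<alpha> e" and ?e = "\<delta> 0 e"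
  note mem = mem_center_iff[OF e(1)] and K = skew_corner_closed[OF e(1)]
    and iff = mem_skew_corner_iff[OF e(1)]
  have KR: "\<And>y. y \<in> ?K \<Longrightarrow> y \<in> R" by (simp add: iff)
  have eR: "?e \<in> R" by (rule single_zero_in_R)
  have e0: "?e \<noteq> 0" using e(2) by (metis lookup_single_eq lookup_zero)
  interpret cring ?C by (rule cring_corner_center[OF e(1)])
  have sel: "mult ?C = skew_mult \<alpha>" "one ?C = ?e" "zero ?C = 0"
    by (simp_all add: corner_center_def)
  have inv: "\<exists>c\<in>carrier ?C. x \<star> c = ?e" if x: "x \<in> carrier ?C" and x0: "x \<noteq> 0" for x
  proof -
    have xK: "x \<in> ?K" and xR: "x \<in> R" and xcomm: "\<And>y. y \<in> ?K \<Longrightarrow> x \<star> y = y \<star> x"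
      using x KR by (auto simp only: mem)
    have ex: "?e \<star> x = x" and xe: "x \<star> ?e = x" using xK by (auto simp: iff)
    define J where "J = {r \<in> R. \<forall>p\<in>R. \<forall>q\<in>R. ?e \<star> (p \<star> (r \<star> (q \<star> ?e))) \<in> (\<star>) x ` ?K}"
    have corner: "?e \<star> (p \<star> ?e) \<in> ?K" if "p \<in> R" for p
      using that eR by (auto simp: skew_corner_def assoc)
    have "x \<in> J"
    proof -
      have "?e \<star> (p \<star> (x \<star> (q \<star> ?e))) = x \<star> ((?e \<star> (p \<star> ?e)) \<star> (?e \<star> (q \<star> ?e)))"
        if "p \<in> R" "q \<in> R" for p q
      proof -
        \<comment> \<open>Writing \<open>x\<close> as \<open>exe\<close> surrounds it by the corner
          elements \<open>epe\<close> and \<open>eqe\<close>, and \<open>x\<close> commutes with the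
          former.\<close>
        have "?e \<star> (p \<star> (x \<star> (q \<star> ?e))) = ?e \<star> (p \<star> ((?e \<star> x \<star> ?e) \<star> (q \<star> ?e)))"
          by (simp add: ex xe)
        also have "\<dots> = (?e \<star> (p \<star> ?e)) \<star> x \<star> (?e \<star> (q \<star> ?e))"
          using that eR xR by (simp add: assoc skew_mult_closed)
        also have "\<dots> = x \<star> (?e \<star> (p \<star> ?e)) \<star> (?e \<star> (q \<star> ?e))"
          using that by (simp add: xcomm corner)
        finally show ?thesis
          using that eR xR by (simp add: assoc skew_mult_closed)
      qed
      then show ?thesis
        using xR by (auto simp: J_def intro!: imageI K corner)
    qed
    have "two_sided_ideal R (skew_mult \<alpha>) J"
      unfolding two_sided_ideal_def
    proof (intro conjI ballI)
      show "J \<subseteq> R" by (auto simp: J_def)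
      show "0 \<in> J" using K(2) by (auto simp: J_def zero_in_R intro!: image_eqI[of _ _ 0])
    next
      fix a b assume "a \<in> J" "b \<in> J"
      show "a + b \<in> J"
        unfolding J_def
      proof (intro CollectI conjI ballI)
        show "a + b \<in> R" using \<open>a \<in> J\<close> \<open>b \<in> J\<close> by (simp add: J_def add_in_R)
        fix p q assume pq: "p \<in> R" "q \<in> R"
        obtain c d where cd: "c \<in> ?K" "?e \<star> (p \<star> (a \<star> (q \<star> ?e))) = x \<star> c"
          "d \<in> ?K" "?e \<star> (p \<star> (b \<star> (q \<star> ?e))) = x \<star> d"
          using \<open>a \<in> J\<close> \<open>b \<in> J\<close> pq unfolding J_def by blast
        then show "?e \<star> (p \<star> ((a + b) \<star> (q \<star> ?e))) \<in> (\<star>) x ` ?K"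
          using \<open>a \<in> J\<close> \<open>b \<in> J\<close> pq eR xR
          by (intro image_eqI[of _ _ "c + d"])
            (auto simp: J_def skew_mult_add_left skew_mult_add_right skew_mult_closed KR K)
      qed
    next
      fix a assume "a \<in> J"
      show "- a \<in> J"
        unfolding J_def
      proof (intro CollectI conjI ballI)
        show "- a \<in> R" using \<open>a \<in> J\<close> by (simp add: J_def minus_in_R)
        fix p q assume pq: "p \<in> R" "q \<in> R"
        obtain c where "c \<in> ?K" "?e \<star> (p \<star> (a \<star> (q \<star> ?e))) = x \<star> c"
          using \<open>a \<in> J\<close> pq unfolding J_def by blast
        then show "?e \<star> (p \<star> ((- a) \<star> (q \<star> ?e))) \<in> (\<star>) x ` ?K"
          using \<open>a \<in> J\<close> pq eR xR
          by (intro image_eqI[of _ _ "- c"])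
            (auto simp: J_def skew_mult_minus_left skew_mult_minus_right skew_mult_closed KR K)
      qed
    next
      fix r a assume r: "r \<in> R" and a: "a \<in> J"
      then have aR: "a \<in> R"
        and *: "\<And>p q. p \<in> R \<Longrightarrow> q \<in> R \<Longrightarrow> ?e \<star> (p \<star> (a \<star> (q \<star> ?e))) \<in> (\<star>) x ` ?K"
        by (auto simp: J_def)
      \<comment> \<open>A factor \<open>r\<close> next to \<open>a\<close> is absorbed into
        \<open>p\<close> on the left or into \<open>q\<close> on the right.\<close>
      have "?e \<star> (p \<star> (r \<star> a \<star> (q \<star> ?e))) \<in> (\<star>) x ` ?K" if "p \<in> R" "q \<in> R" for p q
        using *[of "p \<star> r" q] that r aR eR by (simp add: assoc skew_mult_closed)
      then show "r \<star> a \<in> J" using r aR by (simp add: J_def skew_mult_closed)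
      have "?e \<star> (p \<star> (a \<star> r \<star> (q \<star> ?e))) \<in> (\<star>) x ` ?K" if "p \<in> R" "q \<in> R" for p q
        using *[of p "r \<star> q"] that r aR eR by (simp add: assoc skew_mult_closed)
      then show "a \<star> r \<in> J" using r aR by (simp add: J_def skew_mult_closed)
    qed
    then have "J = R"
      using simple \<open>x \<in> J\<close> x0 by (auto simp: simple_on_def)
    \<comment> \<open>The choice \<open>r = p = q = e\<close> collapses to \<open>e\<close> itself
      and yields an inverse \<open>c\<close> of \<open>x\<close> in the corner.\<close>
    then have "?e \<star> (?e \<star> (?e \<star> (?e \<star> ?e))) \<in> (\<star>) x ` ?K"
      using eR unfolding J_def by blast
    then obtain c where c: "c \<in> ?K" "x \<star> c = ?e"
      by (auto simp: single_idem[OF e(1)])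
    have cx: "c \<star> x = ?e" using c xcomm by metis
    \<comment> \<open>The inverse of a central element is central:
      \<open>cy = cyxc = cxyc = yc\<close>.\<close>
    have "c \<star> y = y \<star> c" if y: "y \<in> ?K" for y
    proof -
      have ye: "y \<star> ?e = y" "?e \<star> y = y" "y \<in> R" "c \<in> R" using y c by (auto simp: iff)
      have "c \<star> y = c \<star> (y \<star> (x \<star> c))" by (simp add: c ye)
      also have "\<dots> = c \<star> (y \<star> x) \<star> c" using ye xR by (simp add: assoc skew_mult_closed)
      also have "\<dots> = c \<star> (x \<star> y) \<star> c" using xcomm[OF y] by simp
      also have "\<dots> = (c \<star> x) \<star> y \<star> c" using ye xR by (simp add: assoc skew_mult_closed)
      finally show ?thesis by (simp add: cx ye)
    qed
    then show ?thesis using c by (auto simp: mem)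
  qed
  show ?thesis
  proof (rule cring_fieldI)
    show "Units ?C = carrier ?C - {\<zero>\<^bsub>?C\<^esub>}"
    proof (intro equalityI subsetI)
      fix x assume "x \<in> Units ?C"
      then show "x \<in> carrier ?C - {\<zero>\<^bsub>?C\<^esub>}"
        using e0 by (auto simp: Units_def sel)
    next
      fix x assume x: "x \<in> carrier ?C - {\<zero>\<^bsub>?C\<^esub>}"
      then obtain c where c: "c \<in> carrier ?C" "x \<star> c = ?e"
        using inv[of x] by (auto simp: sel)
      moreover have "c \<star> x = x \<star> c"
        using x c by (auto simp only: mem)
      ultimately show "x \<in> Units ?C"
        using x by (auto simp: Units_def sel)
    qed
  qed
qed

section \<open>From \<open>G\<close>-simplicity and fields to simplicity of \<open>R\<close>\<close>

lemma simple_if_G_simple: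
  assumes E: "local_units_for UNIV E" and lu: "\<And>t. has_local_units (D t)"
    and G: "G_simple D \<alpha>"
    and fields: "\<And>e. e \<in> E \<Longrightarrow> e \<noteq> 0 \<Longrightarrow> field (corner_center D \<alpha> e)"
  shows "simple_on R (skew_mult \<alpha>)"
  unfolding simple_on_def
proof (intro allI impI)
  fix J assume "two_sided_ideal R (skew_mult \<alpha>) J"
  then have JR: "\<And>x. x \<in> J \<Longrightarrow> x \<in> R" and J0: "0 \<in> J"
    and Jadd: "\<And>x y. x \<in> J \<Longrightarrow> y \<in> J \<Longrightarrow> x + y \<in> J" and Jminus: "\<And>x. x \<in> J \<Longrightarrow> - x \<in> J"
    and Jleft: "\<And>r x. r \<in> R \<Longrightarrow> x \<in> J \<Longrightarrow> r \<star> x \<in> J"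
    and Jright: "\<And>r x. r \<in> R \<Longrightarrow> x \<in> J \<Longrightarrow> x \<star> r \<in> J"
    by (auto simp: two_sided_ideal_def)
  have local_unit: "\<exists>u\<in>D t. u * a = a \<and> a * u = a" if "a \<in> D t" for a t
  proof -
    obtain U where U: "local_units_for (D t) U"
      using lu[of t] by (auto simp: has_local_units_def)
    then have "finite {a} \<and> {a} \<subseteq> D t \<longrightarrow> (\<exists>u\<in>U. \<forall>r\<in>{a}. u * r = r \<and> r * u = r)"
      unfolding local_units_for_def by blast
    with that U show ?thesis unfolding local_units_for_def by blast
  qed
  show "J = {0} \<or> J = R"
  proof (cases "J = {0}")
    case False
    then obtain x0 where "x0 \<in> J \<and> x0 \<noteq> 0" using J0 by blast
    then obtain x where x: "x \<in> J" "x \<noteq> 0"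
      \<comment> \<open>Minimality refers to the number of support points, so it can be compared
        across translated supports.\<close>
      and min: "\<And>y. y \<in> J \<Longrightarrow> y \<noteq> 0 \<Longrightarrow> card (keys x) \<le> card (keys y)"
      using ex_has_least_nat[of "\<lambda>x. x \<in> J \<and> x \<noteq> 0" x0 "\<lambda>x. card (keys x)"] by blast
    obtain t where t: "coeff x t \<noteq> 0" using x(2) by (metis lookup_zero poly_mapping_eqI)
    have "\<alpha> (- t) (coeff x t) \<in> D (- t)" using x(1) by (simp add: \<alpha>_in' coeff_in JR)
    \<comment> \<open>A local unit \<open>c\<close> taken inside \<open>D (- t)\<close> makes
      \<open>\<delta> (- t) c\<close> an element of \<open>R\<close>. Right multiplication by it
      moves \<open>coeff x t\<close> unchanged to degree zero.\<close>
    then obtain c where c: "c \<in> D (- t)" "\<alpha> (- t) (coeff x t) * c = \<alpha> (- t) (coeff x t)"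
      using local_unit by blast
    define z where "z = x \<star> \<delta> (- t) c"
    have zJ: "z \<in> J" using x(1) c(1) by (simp add: z_def Jright single_in_R)
    have z0: "coeff z 0 \<noteq> 0"
      using t x(1) by (simp add: z_def coeff_mult_single c(2) \<alpha>_inverse coeff_in JR)
    have cz: "card (keys z) \<le> card (keys x)"
    proof -
      have "card (keys z) \<le> card ((+) (- t) ` keys x)"
        unfolding z_def by (intro card_mono keys_mult_single) simp
      also have "\<dots> \<le> card (keys x)" by (rule card_image_le) simp
      finally show ?thesis .
    qed
    \<comment> \<open>Requiring only an inclusion of supports makes \<open>L\<close> closed under
      sums, where cancellation may shrink the support.\<close>
    define L where "L = {coeff b 0 | b. b \<in> J \<and> keys b \<subseteq> keys z}"
    have LI: "coeff b 0 \<in> L" if "b \<in> J" "keys b \<subseteq> keys z" for b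
      using that by (auto simp: L_def)
    have "invariant_ideal D \<alpha> L"
      unfolding invariant_ideal_def two_sided_ideal_def
    proof (intro conjI ballI allI)
      show "0 \<in> L" using LI[of 0] J0 by simp
    next
      fix a b assume "a \<in> L" "b \<in> L"
      then obtain a' b' where "a' \<in> J" "keys a' \<subseteq> keys z" "a = coeff a' 0"
        "b' \<in> J" "keys b' \<subseteq> keys z" "b = coeff b' 0" by (auto simp: L_def)
      then show "a + b \<in> L"
        using LI[of "a' + b'"] keys_add[of a' b'] by (auto simp: lookup_add Jadd)
    next
      fix a assume "a \<in> L"
      then obtain a' where "a' \<in> J" "keys a' \<subseteq> keys z" "a = coeff a' 0" by (auto simp: L_def)
      then show "- a \<in> L"
        using LI[of "- a'"] by (auto simp: Jminus)
    next
      fix r a assume "a \<in> L"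
      then obtain a' where a': "a' \<in> J" "keys a' \<subseteq> keys z" "a = coeff a' 0" by (auto simp: L_def)
      then show "r * a \<in> L"
        using LI[of "\<delta> 0 r \<star> a'"] keys_single_mult[of 0 r a']
        by (auto simp: Jleft single_zero_in_R coeff_single_zero_mult)
      from a' show "a * r \<in> L"
        using LI[of "a' \<star> \<delta> 0 r"] keys_mult_single[of a' 0 r]
        by (auto simp: Jright single_zero_in_R coeff_mult_single_zero \<alpha>_zero)
    next
      fix g show "\<alpha> g ` (L \<inter> D (- g)) \<subseteq> L \<inter> D g"
      proof
        fix a' assume "a' \<in> \<alpha> g ` (L \<inter> D (- g))"
        then obtain b where b: "b \<in> J" "keys b \<subseteq> keys z" "coeff b 0 \<in> D (- g)"
          and a': "a' = \<alpha> g (coeff b 0)" by (auto simp: L_def)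
        obtain u where u: "u \<in> D (- g)" "u * coeff b 0 = coeff b 0" "coeff b 0 * u = coeff b 0"
          using local_unit[OF b(3)] by blast
        \<comment> \<open>The two factors shift degrees by \<open>g\<close> and back by
          \<open>- g\<close>. In degree zero they give
          \<open>\<alpha> g (u * coeff b 0 * u)\<close>, which is
          \<open>\<alpha> g (coeff b 0)\<close> because \<open>u\<close> is a local unit for
          \<open>coeff b 0\<close>.\<close>
        define w where "w = \<delta> g (\<alpha> g u) \<star> b \<star> \<delta> (- g) u"
        have "w \<in> J" using b(1) u(1) by (simp add: w_def Jleft Jright single_in_R \<alpha>_in)
        moreover have "keys w \<subseteq> keys z"
        proof -
          have "keys w \<subseteq> (+) (- g) ` (+) g ` keys b"
            unfolding w_def using keys_mult_single keys_single_mult by (meson image_mono subset_trans)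
          with b(2) show ?thesis by (auto simp: image_image)
        qed
        moreover have "coeff w 0 = a'"
          using u b(3) by (simp add: w_def coeff_mult_single coeff_single_mult \<alpha>_inverse' a')
        ultimately show "a' \<in> L \<inter> D g"
          using LI[of w] b(3) a' by (auto simp: \<alpha>_in)
      qed
    qed simp
    moreover have "coeff z 0 \<in> L" using zJ by (intro LI) auto
    ultimately have L: "L = UNIV" using G z0 unfolding G_simple_def by blast
    have eJ: "\<delta> 0 e \<in> J" if eE: "e \<in> E" and e0: "e \<noteq> 0" for e
    proof -
      have ee: "e * e = e" using E eE by (simp add: local_units_for_def)
      let ?C = "corner_center D \<alpha> e" and ?K = "skew_corner D \<alpha> e" and ?e = "\<delta> 0 e"
      note mem = mem_center_iff[OF ee] and iff = mem_skew_corner_iff[OF ee]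
      have eR: "?e \<in> R" by (rule single_zero_in_R)
      have "e \<in> L" by (simp add: L)
      then obtain b' where b': "b' \<in> J" "keys b' \<subseteq> keys z" "coeff b' 0 = e"
        by (auto simp: L_def)
      \<comment> \<open>Cutting down to the corner keeps the degree-zero coefficient, as
        \<open>e * e * e = e\<close>, and does not enlarge the support.\<close>
      define b where "b = ?e \<star> b' \<star> ?e"
      have bJ: "b \<in> J" using b'(1) eR by (simp add: b_def Jleft Jright)
      have bR: "b \<in> R" using bJ by (rule JR)
      have b0: "coeff b 0 = e"
        by (simp add: b_def coeff_mult_single_zero coeff_single_zero_mult \<alpha>_zero b'(3) ee)
      have bK: "b \<in> ?K" using b'(1) by (auto simp: b_def skew_corner_def JR)
      have kb: "keys b \<subseteq> keys z"
        using b'(2) keys_mult_single[of "?e \<star> b'" 0 e] keys_single_mult[of 0 e b']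
        by (auto simp: b_def)
      have "b \<star> y = y \<star> b" if y: "y \<in> ?K" for y
      proof (rule commutes_if_commutes_homogeneous[OF bR])
        show yR: "y \<in> R" using y by (simp add: iff)
        fix t
        let ?y = "\<delta> t (coeff y t)"
        have y': "?y \<in> R" using yR by (simp add: single_in_R coeff_in)
        \<comment> \<open>These are the degree-\<open>t\<close> parts of \<open>ey = y\<close> and
          \<open>ye = y\<close>. Since \<open>coeff b 0 = e\<close>, they say that
          \<open>b \<star> ?y\<close> and \<open>?y \<star> b\<close> both have coefficient
          \<open>coeff y t\<close> in degree \<open>t\<close>.\<close>
        have 1: "e * coeff y t = coeff y t"
          using y coeff_single_zero_mult[of e y t] by (simp add: iff)
        have 2: "\<alpha> t (\<alpha> (- t) (coeff y t) * e) = coeff y t"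
          using y coeff_mult_single_zero[of y e t] by (simp add: iff)
        \<comment> \<open>The commutator is supported in the translate of \<open>keys b\<close> by
          \<open>t\<close> but vanishes at \<open>t\<close> itself. It therefore has fewer support
          points than \<open>x\<close>, and minimality forces it to be zero.\<close>
        define d where "d = b \<star> ?y - ?y \<star> b"
        have "d \<in> J" unfolding d_def diff_conv_add_uminus using bJ y' by (intro Jadd Jminus Jleft Jright)
        moreover have "card (keys d) < card (keys x)"
        proof -
          have "coeff d t = 0"
            by (simp add: d_def lookup_minus coeff_mult_single coeff_single_mult b0 \<alpha>_zero 1 2)
          then have t: "t \<notin> keys d" by (simp add: in_keys_iff)
          have "keys d \<subseteq> keys (b \<star> ?y) \<union> keys (?y \<star> b)"
            unfolding d_def by (rule keys_diff)
          also have "\<dots> \<subseteq> (+) t ` keys b"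
            using keys_mult_single[of b t] keys_single_mult[of t _ b] by simp
          finally have "keys d \<subseteq> (+) t ` keys b - {t}"
            using t by blast
          also have "\<dots> = (+) t ` (keys b - {0})"
            by (simp add: image_set_diff)
          finally have "keys d \<subseteq> (+) t ` (keys b - {0})" .
          then have "card (keys d) \<le> card ((+) t ` (keys b - {0}))"
            by (intro card_mono) auto
          also have "\<dots> \<le> card (keys b - {0})" by (rule card_image_le) simp
          also have "\<dots> < card (keys b)"
            using b0 e0 by (intro card_Diff1_less) (simp_all add: in_keys_iff)
          also have "\<dots> \<le> card (keys z)" using kb by (intro card_mono) auto
          finally show ?thesis using cz by simp
        qed
        ultimately have "d = 0" using min[of d] by force
        then show "b \<star> ?y = ?y \<star> b" by (simp add: d_def)
      qed
      then have bC: "b \<in> carrier ?C" using bK unfolding mem by blast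
      have "b \<noteq> 0" using b0 e0 by auto
      \<comment> \<open>The field hypothesis inverts the nonzero central element \<open>b\<close>,
        so the ideal \<open>J\<close> contains \<open>b \<star> c = \<delta> 0 e\<close>.\<close>
      then have "b \<in> Units ?C"
        using bC field.field_Units[OF fields[OF eE e0]] by (simp add: corner_center_def)
      then obtain c where c: "c \<in> carrier ?C" "b \<star> c = ?e"
        unfolding Units_def by (auto simp: corner_center_def)
      then have "c \<in> R" unfolding mem iff by blast
      then show ?thesis using Jright[of c b] bJ c(2) by simp
    qed
    have "r \<in> J" if r: "r \<in> R" for r
    proof -
      let ?F = "coeff r ` keys r"
      \<comment> \<open>One local unit serves all of the finitely many coefficients of
        \<open>r\<close>, so \<open>\<delta> 0 e\<close> is a left identity for
        \<open>r\<close>.\<close>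
      have "\<exists>e\<in>E. \<forall>a\<in>?F. e * a = a \<and> a * e = a"
        using E unfolding local_units_for_def by (elim conjE allE[of _ ?F]) simp
      then obtain e where e: "e \<in> E" "\<And>a. a \<in> ?F \<Longrightarrow> e * a = a"
        by blast
      have "e * coeff r t = coeff r t" for t
        using e(2)[of "coeff r t"] by (cases "t \<in> keys r") (auto simp: in_keys_iff)
      then have *: "\<delta> 0 e \<star> r = r"
        by (intro poly_mapping_eqI) (simp add: coeff_single_zero_mult)
      show ?thesis
      \<comment> \<open>The local unit found may be \<open>0\<close>, for which no field is assumed;
        then \<open>r = 0\<close>.\<close>
      proof (cases "e = 0")
        case True
        with * J0 show ?thesis by simp
      next
        case False
        then show ?thesis using Jright[OF r eJ[OF e(1)]] by (simp add: *)
      qed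
    qed
    then show ?thesis using JR by blast
  qed simp
qed

end

theorem theorem2p5:
  fixes E :: "'a::ring set"
    and D :: "'g::ab_group_add \<Rightarrow> 'a set"
    and \<alpha> :: "'g \<Rightarrow> 'a \<Rightarrow> 'a"
  assumes "local_units_for UNIV E"
    and "partial_action D \<alpha>"
    and "\<And>t. has_local_units (D t)"
    and "\<And>x y z. x \<in> skew_carrier D \<Longrightarrow> y \<in> skew_carrier D \<Longrightarrow> z \<in> skew_carrier D \<Longrightarrow>
           skew_mult \<alpha> (skew_mult \<alpha> x y) z = skew_mult \<alpha> x (skew_mult \<alpha> y z)"
  shows "simple_on (skew_carrier D) (skew_mult \<alpha>) \<longleftrightarrow>
         G_simple D \<alpha> \<and> (\<forall>e\<in>E. e \<noteq> 0 \<longrightarrow> field (corner_center D \<alpha> e))"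
proof -
  interpret assoc_partial_action D \<alpha>
    using assms(2,4) by (simp add: assoc_partial_action_def assoc_partial_action_axioms_def)
  have "\<And>e. e \<in> E \<Longrightarrow> e * e = e"
    using assms(1) by (simp add: local_units_for_def)
  then show ?thesis
    using G_simple_if_simple field_corner_center_if_simple simple_if_G_simple[OF assms(1,3)]
    by blast
qed

end
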